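(* Let $K$ be a field, $R=K[x_1,\ldots,x_r]$, and let $f\in R$ be a homogeneous polynomial of degree $\deg(f)\geq d\geq 1$. Let $\ell_1,\ldots,\ell_n\in R$ be nonzero linear forms with $n\geq d$. Then the rational function $f/(\ell_1\cdots\ell_n)$ has a PFD of degree $d$ if and only if $f$ vanishes to order at least $d-n+|S|$ on every flat $S\subset[n]$ of size $|S|\geq n-d+1$ of the hyperplane arrangement associated with $\ell_1,\ldots,\ell_n$.
   Context: Notation: $[n]=\{1,\ldots,n\}$. A linear form is a homogeneous polynomial of degree 1. PFD of degree $d$: the rational function $f/(\ell_1\cdots\ell_n)$ has a partial fraction decomposition (PFD) of degree $d$ if there are polynomials $h_J\in R$, indexed by the subsets $J\subset[n]$ with $|J|=n-d$, such that $$\frac{f}{\ell_1\cdots\ell_n}=\sum_{J\subset[n],\,|J|=n-d}\frac{h_J}{\prod_{j\in J}\ell_j},\qquad \deg(h_J)\leq\deg(f)-d \text{ for all } J$$ (the zero polynomial is allowed as a numerator $h_J$). Flats: for $S\subset[n]$ let $\mathrm{rk}(S)$ be the dimension of the $K$-span of $\{\ell_i:i\in S\}$. A flat is a subset $S\subset[n]$ such that $\mathrm{rk}(S\cup\{i\})>\mathrm{rk}(S)$ for all $i\in[n]\setminus S$; equivalently, every $\ell_i$ lying in the span of $\{\ell_j:j\in S\}$ has $i\in S$. The size of the flat is the cardinality $|S|$ as a subset of $[n]$ (the $\ell_i$ need not be distinct, and are counted with repetition). Vanishing order: let $I_S=\langle \ell_i:i\in S\rangle\subset R$. A polynomial $f$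 vanishes to order at least $k$ on $S$ if $f\in (I_S)^k$. *)

theory Defs
  imports
    Complex_Main
    "HOL-Library.Poly_Mapping"
    "HOL-Computational_Algebra.Fraction_Field"
begin

section \<open>Polynomials over a field\<close>

text \<open>
  The polynomial ring \<open>K[x\<^sub>1, \<dots>, x\<^sub>r]\<close> is the monoid algebra of the monomials
  \<^typ>\<open>'x \<Rightarrow>\<^sub>0 nat\<close>, where \<^typ>\<open>'x\<close> is a finite type with \<open>r\<close> elements indexing the
  variables. A linear order on \<^typ>\<open>'x\<close> is what the library requires for the \<^class>\<open>idom\<close>
  instance, hence for the field of rational functions \<open>('x, 'k) mpoly fract\<close>; it plays no other role.
\<close>

type_synonym ('x, 'k) mpoly = "('x \<Rightarrow>\<^sub>0 nat) \<Rightarrow>\<^sub>0 'k"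

definition monom_deg :: "('x \<Rightarrow>\<^sub>0 nat) \<Rightarrow> nat" where
  "monom_deg m = (\<Sum>v\<in>Poly_Mapping.keys m. Poly_Mapping.lookup m v)"

text \<open>Convention: the zero polynomial has \<open>total_deg\<close> 0.\<close>

definition total_deg :: "('x, 'k::zero) mpoly \<Rightarrow> nat" where
  "total_deg p = Max (insert 0 (monom_deg ` Poly_Mapping.keys p))"

text \<open>The zero polynomial is homogeneous of every degree.\<close>

definition homogeneous :: "nat \<Rightarrow> ('x, 'k::zero) mpoly \<Rightarrow> bool" where
  "homogeneous e p \<longleftrightarrow> (\<forall>m\<in>Poly_Mapping.keys p. monom_deg m = e)"

abbreviation linear_form :: "('x, 'k::zero) mpoly \<Rightarrow> bool" where
  "linear_form p \<equiv> homogeneous 1 p"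

definition mpoly_scale :: "'k::field \<Rightarrow> ('x, 'k) mpoly \<Rightarrow> ('x, 'k) mpoly" where
  "mpoly_scale c p = Poly_Mapping.single 0 c * p"

global_interpretation mpoly: vector_space
  "mpoly_scale :: 'k::field \<Rightarrow> ('x, 'k) mpoly \<Rightarrow> ('x, 'k) mpoly"
  defines mpoly_span = mpoly.span
    and mpoly_dim = mpoly.dim
  by unfold_locales
    (simp_all add: mpoly_scale_def algebra_simps single_add mult_single flip: mult.assoc)


section \<open>Ideals and their powers\<close>

text \<open>The ideal generated by a set is its span in the ring regarded as a module over itself.\<close>

definition ideal_gen :: "'a::comm_ring_1 set \<Rightarrow> 'a set" where
  "ideal_gen = module.span (*)"

definition ideal_mult :: "'a::comm_ring_1 set \<Rightarrow> 'a set \<Rightarrow> 'a set" where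
  "ideal_mult I J = ideal_gen {a * b | a b. a \<in> I \<and> b \<in> J}"

primrec ideal_power :: "'a::comm_ring_1 set \<Rightarrow> nat \<Rightarrow> 'a set" where
  "ideal_power I 0 = UNIV"
| "ideal_power I (Suc k) = ideal_mult I (ideal_power I k)"


section \<open>Flats, vanishing order and partial fraction decompositions\<close>

definition rk :: "(nat \<Rightarrow> ('x, 'k::field) mpoly) \<Rightarrow> nat set \<Rightarrow> nat" where
  "rk l S = mpoly_dim (mpoly_span (l ` S))"

definition flat :: "nat \<Rightarrow> (nat \<Rightarrow> ('x, 'k::field) mpoly) \<Rightarrow> nat set \<Rightarrow> bool" where
  "flat n l S \<longleftrightarrow> S \<subseteq> {1..n} \<and> (\<forall>i\<in>{1..n} - S. rk l (S \<union> {i}) > rk l S)"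

definition vanishes_to_order ::
  "nat \<Rightarrow> (nat \<Rightarrow> ('x, 'k::field) mpoly) \<Rightarrow> nat set \<Rightarrow> ('x, 'k) mpoly \<Rightarrow> bool" where
  "vanishes_to_order k l S f \<longleftrightarrow> f \<in> ideal_power (ideal_gen (l ` S)) k"

text \<open>
  The bound \<open>deg h\<^sub>J \<le> deg f - d\<close> is written additively because of truncated subtraction, and
  \<open>h\<^sub>J = 0\<close> is listed separately because of the convention on \<open>total_deg 0\<close>.
\<close>

definition has_PFD ::
  "nat \<Rightarrow> nat \<Rightarrow> (nat \<Rightarrow> ('x::{finite,linorder}, 'k::field) mpoly) \<Rightarrow> ('x, 'k) mpoly \<Rightarrow> bool" where
  "has_PFD d n l f \<longleftrightarrow>
    (\<exists>h :: nat set \<Rightarrow> ('x, 'k) mpoly.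
      Fract f (\<Prod>i\<in>{1..n}. l i) =
        (\<Sum>J | J \<subseteq> {1..n} \<and> card J = n - d. Fract (h J) (\<Prod>j\<in>J. l j)) \<and>
      (\<forall>J. J \<subseteq> {1..n} \<and> card J = n - d \<longrightarrow>
        h J = 0 \<or> total_deg (h J) + d \<le> total_deg f))"

end

theory Submission
  imports Defs "HOL-Computational_Algebra.Polynomial"
begin

text \<open>
  Clearing denominators, a decomposition of degree \<open>d\<close> writes \<open>f\<close> as a combination of the \<open>d\<close>-fold
  products of the \<open>l i\<close>. The ideal of these products is the intersection of the powers
  \<open>I\<^sub>S ^ (d + |S| - n)\<close> over all \<open>S\<close>; passing to the flat spanned by \<open>S\<close> leaves \<open>I\<^sub>S\<close> unchanged and
  raises the exponent, so flats suffice. One inclusion counts the factors indexed by \<open>S\<close>. The other is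
  a deletion-contraction induction on the number of forms, resting on the fact that the order of
  vanishing along \<open>S\<close> is additive on products: a linear form has order 0 outside the span of \<open>S\<close> and,
  if nonzero, at most 1 in any case. This order is the order at \<open>t = 0\<close> of the image of a polynomial
  under a ring homomorphism to \<open>R[t]\<close> that fixes a complement of the span of \<open>S\<close> and multiplies the
  span by \<open>t\<close>.
\<close>

section \<open>Powers of ideals\<close>

text \<open>Submodules of the ring over itself are its ideals, so \<open>ideal.subspace\<close>
  means "is an ideal" throughout.\<close>

interpretation ideal: module "(*) :: 'a::comm_ring_1 \<Rightarrow> 'a \<Rightarrow> 'a"
  by unfold_locales (simp_all add: algebra_simps)

lemma subspace_ideal_gen: "ideal.subspace (ideal_gen A)"
  by (simp add: ideal_gen_def)

lemma subset_ideal_gen: "A \<subseteq> ideal_gen A"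
  by (simp add: ideal_gen_def ideal.span_superset)

lemma ideal_gen_minimal: "A \<subseteq> B \<Longrightarrow> ideal.subspace B \<Longrightarrow> ideal_gen A \<subseteq> B"
  by (simp add: ideal_gen_def ideal.span_minimal)

lemma ideal_gen_mono: "A \<subseteq> B \<Longrightarrow> ideal_gen A \<subseteq> ideal_gen B"
  by (simp add: ideal_gen_def ideal.span_mono)

lemma ideal_gen_eqI: "A \<subseteq> ideal_gen B \<Longrightarrow> B \<subseteq> ideal_gen A \<Longrightarrow> ideal_gen A = ideal_gen B"
  by (meson ideal_gen_minimal subset_antisym subspace_ideal_gen)

lemma subspace_ideal_power: "ideal.subspace (ideal_power I k)"
  by (cases k) (simp_all add: ideal_mult_def subspace_ideal_gen)

lemma mult_in_ideal_power_Suc: "a \<in> I \<Longrightarrow> b \<in> ideal_power I k \<Longrightarrow> a * b \<in> ideal_power I (Suc k)"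
  using subset_ideal_gen[of "{a * b |a b. a \<in> I \<and> b \<in> ideal_power I k}"]
  by (auto simp: ideal_mult_def)

lemma ideal_power_Suc_subset: "ideal_power I (Suc k) \<subseteq> ideal_power I k"
  unfolding ideal_power.simps ideal_mult_def
  by (rule ideal_gen_minimal) (auto simp: subspace_ideal_power intro: ideal.subspace_scale)

lemma ideal_power_antimono: "j \<le> k \<Longrightarrow> ideal_power I k \<subseteq> ideal_power I j"
  by (rule lift_Suc_antimono_le) (rule ideal_power_Suc_subset)

lemma ideal_power_1_gen_subset: "ideal_power (ideal_gen A) 1 \<subseteq> ideal_gen A"
proof -
  have "a * b \<in> ideal_gen A" if "a \<in> ideal_gen A" for a b
    using ideal.subspace_scale[OF subspace_ideal_gen that, of b] by (simp only: mult.commute)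
  then show ?thesis
    unfolding One_nat_def ideal_power.simps ideal_mult_def
    by (intro ideal_gen_minimal subspace_ideal_gen) auto
qed

text \<open>Lets a membership \<open>a * b \<in> P\<close>, wanted for all \<open>a\<close> in an
  ideal, be checked on generators of that ideal.\<close>

lemma subspace_colon:
  fixes P :: "'a::comm_ring_1 set"
  assumes "ideal.subspace P"
  shows "ideal.subspace {a. a * b \<in> P}"
proof (rule ideal.subspaceI)
  show "0 \<in> {a. a * b \<in> P}" by (simp add: ideal.subspace_0[OF assms])
next
  fix x y assume "x \<in> {a. a * b \<in> P}" "y \<in> {a. a * b \<in> P}"
  then show "x + y \<in> {a. a * b \<in> P}"
    unfolding mem_Collect_eq distrib_right by (rule ideal.subspace_add[OF assms])
next
  fix c x assume "x \<in> {a. a * b \<in> P}"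
  then show "c * x \<in> {a. a * b \<in> P}"
    unfolding mem_Collect_eq mult.assoc by (rule ideal.subspace_scale[OF assms])
qed

text \<open>Compares the powers of an ideal with a filtration by ideals \<open>P k\<close>, looking
  at generators only. It is applied to divisibility by powers of \<open>t\<close> and to preimages
  under a ring homomorphism.\<close>

lemma ideal_power_gen_induct:
  assumes zero: "P 0 = UNIV"
    and sub: "\<And>k. ideal.subspace (P k)"
    and step: "\<And>u b k. u \<in> U \<Longrightarrow> b \<in> P k \<Longrightarrow> u * b \<in> P (Suc k)"
  shows "ideal_power (ideal_gen U) k \<subseteq> P k"
proof (induction k)
  case 0
  then show ?case by (simp add: zero)
next
  case (Suc k)
  have "a * b \<in> P (Suc k)" if a: "a \<in> ideal_gen U" and b: "b \<in> P k" for a b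
  proof -
    have "ideal_gen U \<subseteq> {a. a * b \<in> P (Suc k)}"
      using step[OF _ b] by (intro ideal_gen_minimal subspace_colon sub) auto
    then show ?thesis using a by blast
  qed
  then show ?case
    unfolding ideal_power.simps ideal_mult_def
    using Suc.IH by (intro ideal_gen_minimal sub) auto
qed

lemma mult_in_ideal_power_add:
  assumes "a \<in> ideal_power I j" and b: "b \<in> ideal_power I k"
  shows "a * b \<in> ideal_power I (j + k)"
  using assms(1)
proof (induction j arbitrary: a)
  case 0
  then show ?case using b by (simp add: ideal.subspace_scale[OF subspace_ideal_power])
next
  case (Suc j)
  have "ideal_gen {x * y |x y. x \<in> I \<and> y \<in> ideal_power I j}
      \<subseteq> {a. a * b \<in> ideal_power I (Suc j + k)}"
  proof (intro ideal_gen_minimal subspace_colon subspace_ideal_power subsetI)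
    fix a assume "a \<in> {x * y |x y. x \<in> I \<and> y \<in> ideal_power I j}"
    then obtain x y where a: "a = x * y" and x: "x \<in> I" and y: "y \<in> ideal_power I j" by blast
    have "x * (y * b) \<in> ideal_power I (Suc (j + k))"
      by (rule mult_in_ideal_power_Suc[OF x Suc.IH[OF y]])
    then show "a \<in> {a. a * b \<in> ideal_power I (Suc j + k)}"
      by (simp only: a mult.assoc add_Suc mem_Collect_eq)
  qed
  then show ?case using Suc.prems by (auto simp: ideal_mult_def)
qed

lemma power_in_ideal_power: "a \<in> I \<Longrightarrow> a ^ k \<in> ideal_power I k"
  by (induction k) (auto intro: mult_in_ideal_power_Suc simp del: ideal_power.simps(2))

lemma prod_in_ideal_power:
  "finite A \<Longrightarrow> (\<And>i. i \<in> A \<Longrightarrow> g i \<in> I) \<Longrightarrow> prod g A \<in> ideal_power I (card A)"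
  by (induction A rule: finite_induct) (simp_all add: mult_in_ideal_power_Suc del: ideal_power.simps(2))

section \<open>Linear forms\<close>

definition Var :: "'x \<Rightarrow> ('x, 'k::field) mpoly" where
  "Var v = Poly_Mapping.single (Poly_Mapping.single v 1) 1"

text \<open>Scaling is multiplication by a constant polynomial, so every ideal is a vector
  subspace.\<close>

lemma mpoly_span_subset_ideal_gen: "mpoly_span U \<subseteq> ideal_gen U"
proof (rule mpoly.span_minimal[OF subset_ideal_gen])
  show "mpoly.subspace (ideal_gen U)"
    using subspace_ideal_gen[of U] by (auto simp: mpoly.subspace_def ideal.subspace_def mpoly_scale_def)
qed

lemma monom_deg_eq_sum: "monom_deg m = (\<Sum>v\<in>UNIV. Poly_Mapping.lookup (m :: 'x::finite \<Rightarrow>\<^sub>0 nat) v)"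
  unfolding monom_deg_def by (rule sum.mono_neutral_left) (auto simp: in_keys_iff)

lemma sum_single_lookup: "(\<Sum>v\<in>UNIV. Poly_Mapping.single v (Poly_Mapping.lookup m v)) = (m :: 'x::finite \<Rightarrow>\<^sub>0 nat)"
  by (rule poly_mapping_eqI) (simp add: lookup_sum lookup_single when_def)

lemma sum_keys_single:
  "(\<Sum>m\<in>Poly_Mapping.keys p. Poly_Mapping.single m (Poly_Mapping.lookup p m)) = p"
  by (rule poly_mapping_eqI) (auto simp: lookup_sum lookup_single when_def in_keys_iff sum.delta)

lemma Var_power: "Var v ^ k = Poly_Mapping.single (Poly_Mapping.single v k) 1"
  by (induction k) (simp_all add: Var_def mult_single flip: single_add)

lemma prod_single_one:
  "(\<Prod>v\<in>A. Poly_Mapping.single (g v) (1::'k::comm_semiring_1)) = Poly_Mapping.single (\<Sum>v\<in>A. g v :: 'm::comm_monoid_add) 1"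
  by (induction A rule: infinite_finite_induct) (simp_all add: mult_single)

lemma prod_Var_power:
  "(\<Prod>v\<in>UNIV. Var v ^ Poly_Mapping.lookup m v) = Poly_Mapping.single (m :: 'x::finite \<Rightarrow>\<^sub>0 nat) 1"
  by (simp add: Var_power prod_single_one sum_single_lookup)

lemma monom_deg_eq_1E:
  fixes m :: "'x::finite \<Rightarrow>\<^sub>0 nat"
  assumes "monom_deg m = 1"
  obtains v where "m = Poly_Mapping.single v 1"
proof -
  have "(\<Sum>v\<in>UNIV. Poly_Mapping.lookup m v) = 1" using assms by (simp add: monom_deg_eq_sum)
  then obtain v where v: "Poly_Mapping.lookup m v = 1" "\<And>w. v \<noteq> w \<Longrightarrow> Poly_Mapping.lookup m w = 0"
    unfolding sum_eq_1_iff[OF finite] by auto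
  have "m = Poly_Mapping.single v 1"
    using v by (intro poly_mapping_eqI) (auto simp: lookup_single when_def)
  then show ?thesis by (rule that)
qed

lemma homogeneous_add: "homogeneous e p \<Longrightarrow> homogeneous e q \<Longrightarrow> homogeneous e (p + q)"
  using keys_add[of p q] by (auto simp: homogeneous_def)

lemma homogeneous_scale: "homogeneous e p \<Longrightarrow> homogeneous e (mpoly_scale c p)"
  using keys_mult[of "Poly_Mapping.single 0 c" p]
  by (fastforce simp: homogeneous_def mpoly_scale_def split: if_splits)

lemma subspace_homogeneous: "mpoly.subspace {p. homogeneous e p}"
  by (auto simp: mpoly.subspace_def homogeneous_add homogeneous_scale) (simp add: homogeneous_def)

lemma linear_form_in_span:
  fixes y :: "('x::finite, 'k::field) mpoly"
  assumes "linear_form y"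
  shows "y \<in> mpoly_span (range Var)"
proof -
  have "Poly_Mapping.single m (Poly_Mapping.lookup y m) \<in> mpoly_span (range Var)"
    if m: "m \<in> Poly_Mapping.keys y" for m
  proof -
    obtain v where "m = Poly_Mapping.single v 1"
      using assms m monom_deg_eq_1E by (auto simp: homogeneous_def)
    then have "Poly_Mapping.single m (Poly_Mapping.lookup y m) = mpoly_scale (Poly_Mapping.lookup y m) (Var v)"
      by (simp add: mpoly_scale_def mult_single Var_def)
    then show ?thesis by (simp add: mpoly.span_scale mpoly.span_base)
  qed
  then have "(\<Sum>m\<in>Poly_Mapping.keys y. Poly_Mapping.single m (Poly_Mapping.lookup y m)) \<in> mpoly_span (range Var)"
    by (rule mpoly.span_sum)
  then show ?thesis by (simp only: sum_keys_single)
qed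

interpretation mpoly_pair: vector_space_pair
  "mpoly_scale :: 'k::field \<Rightarrow> ('x, 'k) mpoly \<Rightarrow> ('x, 'k) mpoly"
  "mpoly_scale :: 'k::field \<Rightarrow> ('x, 'k) mpoly \<Rightarrow> ('x, 'k) mpoly"
  ..

section \<open>The pencil along a subspace\<close>

text \<open>The axioms make \<open>\<pi>\<close> a linear projection with kernel exactly
  \<open>mpoly_span U\<close>; applying it to \<open>y - \<pi> y\<close> gives idempotence.\<close>

locale pencil =
  fixes \<pi> :: "('x::finite, 'k::field) mpoly \<Rightarrow> ('x, 'k) mpoly"
    and U :: "('x, 'k) mpoly set"
  assumes linear: "Vector_Spaces.linear mpoly_scale mpoly_scale \<pi>"
    and kernel: "y \<in> mpoly_span U \<Longrightarrow> \<pi> y = 0"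
    and complement: "y - \<pi> y \<in> mpoly_span U"
begin

text \<open>Substitution of \<open>\<pi> (Var v) + t * (Var v - \<pi> (Var v))\<close> for each
  variable, where \<open>t\<close> is the indeterminate of the outer polynomial.\<close>

definition \<theta> :: "('x, 'k) mpoly \<Rightarrow> ('x, 'k) mpoly poly" where
  "\<theta> p = (\<Sum>m\<in>Poly_Mapping.keys p. [:Poly_Mapping.single 0 (Poly_Mapping.lookup p m):] *
     (\<Prod>v\<in>UNIV. [:\<pi> (Var v), Var v - \<pi> (Var v):] ^ Poly_Mapping.lookup m v))"

lemma \<theta>_add: "\<theta> (p + q) = \<theta> p + \<theta> q"
  unfolding \<theta>_def
  by (rule setsum_keys_plus_distrib) (simp_all add: single_add smult_add_left)

lemma \<theta>_0 [simp]: "\<theta> 0 = 0"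
  by (simp add: \<theta>_def)

lemma \<theta>_sum: "\<theta> (sum g A) = (\<Sum>i\<in>A. \<theta> (g i))"
  by (induction A rule: infinite_finite_induct) (simp_all add: \<theta>_add)

lemma \<theta>_single: "\<theta> (Poly_Mapping.single m c) = [:Poly_Mapping.single 0 c:] *
     (\<Prod>v\<in>UNIV. [:\<pi> (Var v), Var v - \<pi> (Var v):] ^ Poly_Mapping.lookup m v)"
  by (simp add: \<theta>_def)

text \<open>Both sides are biadditive, which leaves products of two single terms; there exponents
  add and coefficients multiply.\<close>

lemma \<theta>_mult: "\<theta> (p * q) = \<theta> p * \<theta> q"
proof -
  have single: "\<theta> (Poly_Mapping.single m c * Poly_Mapping.single m' c')
      = \<theta> (Poly_Mapping.single m c) * \<theta> (Poly_Mapping.single m' c')" for m m' c c'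
  proof -
    have const: "[:Poly_Mapping.single 0 (c * c') :: ('x, 'k) mpoly:] = [:Poly_Mapping.single 0 c:] * [:Poly_Mapping.single 0 c':]"
      by (simp add: mult_single mult.commute)
    show ?thesis
      unfolding mult_single const \<theta>_single lookup_add power_add prod.distrib by (simp only: mult_ac)
  qed
  let ?s = "\<lambda>p m. Poly_Mapping.single m (Poly_Mapping.lookup p m)"
  have "\<theta> ((\<Sum>m\<in>Poly_Mapping.keys p. ?s p m) * (\<Sum>m\<in>Poly_Mapping.keys q. ?s q m))
      = \<theta> (\<Sum>m\<in>Poly_Mapping.keys p. ?s p m) * \<theta> (\<Sum>m\<in>Poly_Mapping.keys q. ?s q m)"
    by (simp only: sum_product \<theta>_sum single)
  then show ?thesis by (simp only: sum_keys_single)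
qed

lemma \<theta>_1 [simp]: "\<theta> 1 = 1"
  using \<theta>_single[of 0 1] by simp

lemma \<theta>_prod: "\<theta> (prod g A) = (\<Prod>i\<in>A. \<theta> (g i))"
  by (induction A rule: infinite_finite_induct) (simp_all add: \<theta>_mult)

text \<open>Both sides are linear in \<open>y\<close>, so it suffices to treat variables.\<close>

lemma \<theta>_linear_form:
  assumes "linear_form y"
  shows "\<theta> y = [:\<pi> y, y - \<pi> y:]"
  using linear_form_in_span[OF assms]
proof (induction y rule: mpoly.span_induct_alt)
  case base
  then show ?case using mpoly_pair.linear_0[OF linear] by simp
next
  case (step c x y)
  then obtain v where v: "x = Var v" by auto
  have "\<theta> (mpoly_scale c x) = smult (Poly_Mapping.single 0 c) [:\<pi> x, x - \<pi> x:]"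
  proof -
    have "(\<Prod>w\<in>UNIV. [:\<pi> (Var w), Var w - \<pi> (Var w):] ^ Poly_Mapping.lookup (Poly_Mapping.single v 1) w)
       = (\<Prod>w\<in>UNIV. if w = v then [:\<pi> (Var w), Var w - \<pi> (Var w):] else 1)"
      by (intro prod.cong) (auto simp: lookup_single when_def)
    also have "\<dots> = [:\<pi> x, x - \<pi> x:]"
      by (simp add: v)
    finally have prod: "(\<Prod>w\<in>UNIV. [:\<pi> (Var w), Var w - \<pi> (Var w):] ^
        Poly_Mapping.lookup (Poly_Mapping.single v 1) w) = [:\<pi> x, x - \<pi> x:]" .
    have "mpoly_scale c x = Poly_Mapping.single (Poly_Mapping.single v 1) c"
      by (simp add: v Var_def mpoly_scale_def mult_single)
    then have "\<theta> (mpoly_scale c x) = [:Poly_Mapping.single 0 c:] * [:\<pi> x, x - \<pi> x:]"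
      by (simp only: \<theta>_single prod)
    then show ?thesis by simp
  qed
  then show ?case
    using step.IH
    by (simp add: \<theta>_add mpoly_pair.linear_add[OF linear] mpoly_pair.linear_scale[OF linear])
      (simp add: mpoly_scale_def right_diff_distrib)
qed

lemma poly_\<theta>_1: "poly (\<theta> p) 1 = p"
proof -
  have "poly (\<theta> p) 1 = (\<Sum>m\<in>Poly_Mapping.keys p. Poly_Mapping.single m (Poly_Mapping.lookup p m))"
    unfolding \<theta>_def poly_sum poly_mult poly_prod poly_power by (simp add: prod_Var_power mult_single)
  then show ?thesis by (simp only: sum_keys_single)
qed

text \<open>The set \<open>?G\<close> is the Rees algebra of the ideal. It is a ring containing the
  constants and the linear factors from which \<open>\<theta> p\<close> is built.\<close>

lemma coeff_\<theta>_in_ideal_power: "coeff (\<theta> p) j \<in> ideal_power (ideal_gen U) j"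
proof -
  let ?I = "ideal_power (ideal_gen U)"
  let ?G = "{q. \<forall>j. coeff q j \<in> ?I j}"
  have sum: "sum g A \<in> ?G" if "\<And>a. a \<in> A \<Longrightarrow> g a \<in> ?G" for g and A :: "'i set"
    using that by (auto simp: coeff_sum intro!: ideal.subspace_sum[OF subspace_ideal_power])
  have mult: "q * q' \<in> ?G" if "q \<in> ?G" "q' \<in> ?G" for q q'
  proof -
    have "coeff q i * coeff q' (n - i) \<in> ?I n" if "i \<le> n" for i n
      using mult_in_ideal_power_add[of "coeff q i" _ i "coeff q' (n - i)" "n - i"] that \<open>q \<in> ?G\<close> \<open>q' \<in> ?G\<close> by auto
    then show ?thesis
      by (auto simp: coeff_mult intro!: ideal.subspace_sum[OF subspace_ideal_power])
  qed
  have const: "[:c:] \<in> ?G" for c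
    using ideal.subspace_0[OF subspace_ideal_power]
    by (auto simp: coeff_pCons split: nat.split simp del: ideal_power.simps(2))
  have one: "1 \<in> ?G" using const[of 1] by (simp add: one_pCons)
  have power: "q ^ k \<in> ?G" if "q \<in> ?G" for q k
    by (induction k) (use one mult that in simp_all)
  have prod: "prod g A \<in> ?G" if "\<And>a. a \<in> A \<Longrightarrow> g a \<in> ?G" for g and A :: "'x set"
    using finite[of A] that by (induction A rule: finite_induct) (use one mult in simp_all)
  have var: "[:\<pi> y, y - \<pi> y:] \<in> ?G" for y
  proof -
    have "y - \<pi> y \<in> ?I 1"
      using complement[of y] mpoly_span_subset_ideal_gen[of U]
        power_in_ideal_power[of "y - \<pi> y" "ideal_gen U" 1] by auto
    then show ?thesis
      using ideal.subspace_0[OF subspace_ideal_power]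
      by (auto simp: coeff_pCons split: nat.split simp del: ideal_power.simps(2))
  qed
  have "\<theta> p \<in> ?G"
    unfolding \<theta>_def by (intro sum mult const prod power var)
  then show ?thesis by simp
qed

text \<open>Left to right, a generator \<open>u\<close> goes to \<open>t * u\<close>, so each
  generator factor contributes a power of \<open>t\<close>. Right to left, only coefficients of
  index at least \<open>k\<close> survive; they lie in the \<open>k\<close>-th power, and
  \<open>t = 1\<close> adds them up to \<open>p\<close>.\<close>

lemma in_ideal_power_iff:
  assumes U: "\<And>u. u \<in> U \<Longrightarrow> linear_form u"
  shows "p \<in> ideal_power (ideal_gen U) k \<longleftrightarrow> monom 1 k dvd \<theta> p"
proof
  let ?P = "\<lambda>k. {p. monom 1 k dvd \<theta> p}"
  have "ideal_power (ideal_gen U) k \<subseteq> ?P k"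
  proof (rule ideal_power_gen_induct)
    show "?P 0 = UNIV" by simp
    show "ideal.subspace (?P k)" for k
      by (auto simp: ideal.subspace_def \<theta>_add \<theta>_mult)
    fix u b k assume u: "u \<in> U" and b: "b \<in> ?P k"
    have "\<theta> u = monom 1 1 * [:u:]"
      using \<theta>_linear_form[OF U[OF u]] kernel[OF mpoly.span_base[OF u]] by (simp add: monom_altdef)
    then have "monom 1 1 dvd \<theta> u" by (rule dvdI)
    then have "monom 1 1 * monom 1 k dvd \<theta> u * \<theta> b"
      using b by (intro mult_dvd_mono) auto
    then show "u * b \<in> ?P (Suc k)"
      by (simp add: \<theta>_mult mult_monom)
  qed
  then show "monom 1 k dvd \<theta> p" if "p \<in> ideal_power (ideal_gen U) k"
    using that by blast
next
  assume "monom 1 k dvd \<theta> p"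
  then have "coeff (\<theta> p) j = 0" if "j < k" for j
    using that by (auto simp: coeff_monom_mult elim!: dvdE)
  then have "coeff (\<theta> p) j \<in> ideal_power (ideal_gen U) k" for j
    using coeff_\<theta>_in_ideal_power[of p j] ideal_power_antimono[of k j "ideal_gen U"]
      ideal.subspace_0[OF subspace_ideal_power, of "ideal_gen U" k]
    by (cases "j < k") auto
  then have "poly (\<theta> p) 1 \<in> ideal_power (ideal_gen U) k"
    unfolding poly_altdef by (auto intro: ideal.subspace_sum[OF subspace_ideal_power])
  then show "p \<in> ideal_power (ideal_gen U) k" by (simp only: poly_\<theta>_1)
qed

end

text \<open>A basis \<open>B\<close> of the span, chosen inside \<open>U\<close>, is extended to a
  basis \<open>C\<close> of the whole ring; \<open>\<pi>\<close> kills \<open>B\<close> and fixes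
  the rest of \<open>C\<close>.\<close>

lemma exists_pencil: "\<exists>\<pi>. pencil \<pi> (U :: ('x::finite, 'k::field) mpoly set)"
proof -
  obtain B where B: "B \<subseteq> U" "\<not> mpoly.dependent B" "U \<subseteq> mpoly_span B"
    by (rule mpoly.maximal_independent_subset)
  have span: "mpoly_span U = mpoly_span B"
    using B by (metis mpoly.span_mono mpoly.span_minimal mpoly.subspace_span subset_antisym)
  define C where "C = mpoly.extend_basis B"
  define \<pi> where "\<pi> = mpoly_pair.construct C (\<lambda>b. if b \<in> B then 0 else b)"
  have C: "\<not> mpoly.dependent C" "B \<subseteq> C" "mpoly_span C = UNIV"
    using B(2) by (simp_all add: C_def mpoly.independent_extend_basis mpoly.extend_basis_superset
        mpoly.span_extend_basis)
  have lin: "Vector_Spaces.linear mpoly_scale mpoly_scale \<pi>"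
    unfolding \<pi>_def by (rule mpoly_pair.linear_construct[OF C(1)])
  have basis: "\<pi> b = (if b \<in> B then 0 else b)" if "b \<in> C" for b
    unfolding \<pi>_def using mpoly_pair.construct_basis[OF C(1) that] .
  have "pencil \<pi> U"
  proof (rule pencil.intro)
    show "\<pi> y = 0" if "y \<in> mpoly_span U" for y
    proof (rule mpoly_pair.linear_eq_0_on_span[OF lin _ that[unfolded span]])
      show "\<pi> b = 0" if "b \<in> B" for b
        using basis[of b] that C(2) by auto
    qed
    show "y - \<pi> y \<in> mpoly_span U" for y
    proof -
      have "y \<in> mpoly_span C" by (simp add: C(3))
      then show ?thesis
      proof (induction y rule: mpoly.span_induct_alt)
        case base
        then show ?case by (simp add: mpoly_pair.linear_0[OF lin] mpoly.span_zero)
      next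
        case (step c x y)
        have "x - \<pi> x \<in> mpoly_span U"
          using step(1) basis[of x] by (auto simp: span mpoly.span_zero mpoly.span_base)
        then have "mpoly_scale c (x - \<pi> x) + (y - \<pi> y) \<in> mpoly_span U"
          using step by (intro mpoly.span_add mpoly.span_scale) auto
        then show ?case
          by (simp add: mpoly_pair.linear_add[OF lin] mpoly_pair.linear_scale[OF lin]
              mpoly.scale_right_diff_distrib algebra_simps)
      qed
    qed
  qed (rule lin)
  then show ?thesis by (rule exI[of _ \<pi>])
qed

section \<open>Cancelling a linear form from a vanishing order\<close>

text \<open>Outside the span \<open>\<pi> x \<noteq> 0\<close>, so \<open>\<theta> x\<close> has a
  nonzero constant term and order 0 at \<open>t = 0\<close>; orders add on products.\<close>

lemma cancel_linear_form_outside_span: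
  fixes f x :: "('x::{finite,linorder}, 'k::field) mpoly"
  assumes U: "\<And>u. u \<in> U \<Longrightarrow> linear_form u" and x: "linear_form x" "x \<notin> mpoly_span U"
    and xf: "x * f \<in> ideal_power (ideal_gen U) k"
  shows "f \<in> ideal_power (ideal_gen U) k"
proof (cases "f = 0")
  case True
  then show ?thesis by (simp add: ideal.subspace_0[OF subspace_ideal_power])
next
  case False
  obtain \<pi> where "pencil \<pi> U" using exists_pencil by blast
  then interpret pencil \<pi> U .
  have "\<pi> x \<noteq> 0" using complement[of x] x(2) by auto
  then have \<theta>x: "\<theta> x \<noteq> 0" "order 0 (\<theta> x) = 0"
    using \<theta>_linear_form[OF x(1)] by (auto intro: order_0I)
  have \<theta>f: "\<theta> f \<noteq> 0" using False poly_\<theta>_1[of f] by auto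
  have "monom 1 k dvd \<theta> x * \<theta> f"
    using xf by (simp add: in_ideal_power_iff[OF U] \<theta>_mult)
  then show ?thesis
    using \<theta>x \<theta>f by (simp add: in_ideal_power_iff[OF U] monom_1_dvd_iff order_mult)
qed

text \<open>As \<open>\<theta> x\<close> is nonzero of degree at most 1 in \<open>t\<close>, its
  order is at most 1.\<close>

lemma cancel_linear_form_Suc:
  fixes f x :: "('x::{finite,linorder}, 'k::field) mpoly"
  assumes U: "\<And>u. u \<in> U \<Longrightarrow> linear_form u" and x: "linear_form x" "x \<noteq> 0"
    and xf: "x * f \<in> ideal_power (ideal_gen U) (Suc k)"
  shows "f \<in> ideal_power (ideal_gen U) k"
proof (cases "f = 0")
  case True
  then show ?thesis by (simp add: ideal.subspace_0[OF subspace_ideal_power])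
next
  case False
  obtain \<pi> where "pencil \<pi> U" using exists_pencil by blast
  then interpret pencil \<pi> U .
  have \<theta>: "\<theta> x \<noteq> 0" "\<theta> f \<noteq> 0" using False x(2) poly_\<theta>_1[of f] poly_\<theta>_1[of x] by auto
  have "order 0 (\<theta> x) \<le> degree (\<theta> x)" by (rule order_degree[OF \<theta>(1)])
  also have "\<dots> \<le> 1" by (simp add: \<theta>_linear_form[OF x(1)])
  finally have ord: "order 0 (\<theta> x) \<le> 1" .
  have "monom 1 (Suc k) dvd \<theta> x * \<theta> f"
    using xf by (simp add: in_ideal_power_iff[OF U] \<theta>_mult del: ideal_power.simps)
  then show ?thesis
    using ord \<theta> by (simp add: in_ideal_power_iff[OF U] monom_1_dvd_iff order_mult)
qed

section \<open>Ideals of fold products\<close>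

text \<open>Products run over index sets, so equal forms at different indices count
  separately.\<close>

definition fold_products :: "(nat \<Rightarrow> 'a::comm_ring_1) \<Rightarrow> nat set \<Rightarrow> nat \<Rightarrow> 'a set" where
  "fold_products l N d = (\<lambda>A. \<Prod>i\<in>A. l i) ` {A. A \<subseteq> N \<and> card A = d}"

lemma fold_products_mono: "N \<subseteq> M \<Longrightarrow> fold_products l N d \<subseteq> fold_products l M d"
  by (auto simp: fold_products_def)

text \<open>A \<open>d\<close>-subset \<open>A\<close> of \<open>N\<close> meets \<open>S\<close> in
  at least \<open>d + card S - card N\<close> indices, and those factors lie in the ideal of
  \<open>S\<close>. A negative bound is truncated to exponent 0, the whole ring.\<close>

lemma ideal_gen_fold_products_subset:
  assumes N: "finite N" and S: "S \<subseteq> N"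
  shows "ideal_gen (fold_products l N d) \<subseteq> ideal_power (ideal_gen (l ` S)) (d + card S - card N)"
proof (rule ideal_gen_minimal[OF _ subspace_ideal_power], rule subsetI)
  fix p assume "p \<in> fold_products l N d"
  then obtain A where A: "A \<subseteq> N" "card A = d" and p: "p = (\<Prod>i\<in>A. l i)"
    by (auto simp: fold_products_def)
  note fin = finite_subset[OF A(1) N] finite_subset[OF S N]
  have "card (A \<union> S) \<le> card N" using A S N by (intro card_mono) auto
  then have card: "d + card S - card N \<le> card (A \<inter> S)"
    using card_Un_Int[OF fin] A(2) by simp
  have "(\<Prod>i\<in>A \<inter> S. l i) \<in> ideal_power (ideal_gen (l ` S)) (card (A \<inter> S))"
    using subset_ideal_gen[of "l ` S"] fin by (intro prod_in_ideal_power) auto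
  then have "(\<Prod>i\<in>A \<inter> S. l i) \<in> ideal_power (ideal_gen (l ` S)) (d + card S - card N)"
    using ideal_power_antimono[OF card] by blast
  then have "(\<Prod>i\<in>A - S. l i) * (\<Prod>i\<in>A \<inter> S. l i) \<in> ideal_power (ideal_gen (l ` S)) (d + card S - card N)"
    by (rule ideal.subspace_scale[OF subspace_ideal_power])
  also have "(\<Prod>i\<in>A - S. l i) * (\<Prod>i\<in>A \<inter> S. l i) = p"
    unfolding p using prod.Int_Diff[OF fin(1), of l S] by (simp add: mult.commute)
  finally show "p \<in> ideal_power (ideal_gen (l ` S)) (d + card S - card N)" .
qed

lemma mult_in_ideal_gen_fold_products:
  assumes "finite N" "a \<notin> N" "p \<in> ideal_gen (fold_products l N d)"
  shows "l a * p \<in> ideal_gen (fold_products l (insert a N) (Suc d))"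
proof -
  have "ideal_gen (fold_products l N d) \<subseteq> {p. p * l a \<in> ideal_gen (fold_products l (insert a N) (Suc d))}"
  proof (intro ideal_gen_minimal subspace_colon subspace_ideal_gen subsetI)
    fix p assume "p \<in> fold_products l N d"
    then obtain A where A: "A \<subseteq> N" "card A = d" and p: "p = (\<Prod>i\<in>A. l i)"
      by (auto simp: fold_products_def)
    have fin: "finite A" using A assms(1) finite_subset by blast
    moreover have "a \<notin> A" using A assms(2) by blast
    ultimately have "p * l a = (\<Prod>i\<in>insert a A. l i)" "card (insert a A) = Suc d"
      using A(2) by (simp_all add: p mult.commute)
    then have "p * l a \<in> fold_products l (insert a N) (Suc d)"
      using A(1) by (auto simp: fold_products_def intro!: image_eqI[of _ _ "insert a A"])
    then show "p \<in> {p. p * l a \<in> ideal_gen (fold_products l (insert a N) (Suc d))}"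
      using subset_ideal_gen by auto
  qed
  then show ?thesis using assms(3) by (auto simp: mult.commute)
qed

text \<open>The value at \<open>t = 0\<close> of the pencil along \<open>x\<close>. It models the
  quotient by \<open>x\<close> inside the same polynomial ring, where the induction on the forms can
  continue.\<close>

lemma exists_projection_along_linear_form:
  fixes x :: "('x::finite, 'k::field) mpoly"
  assumes x: "linear_form x"
  obtains \<phi> where "\<And>p q. \<phi> (p + q) = \<phi> p + \<phi> q" "\<And>p q. \<phi> (p * q) = \<phi> p * \<phi> q" "\<phi> 1 = 1" "\<phi> 0 = 0"
    "\<phi> x = 0" "\<And>p. x dvd p - \<phi> p" "\<And>y. linear_form y \<Longrightarrow> linear_form (\<phi> y)"
proof -
  obtain \<pi> where "pencil \<pi> {x}" using exists_pencil by blast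
  then interpret pencil \<pi> "{x}" .
  define \<phi> where "\<phi> = (\<lambda>p. poly (\<theta> p) 0)"
  have "x dvd p - \<phi> p" for p
  proof -
    have ideal: "ideal_gen {x} \<subseteq> {p. x dvd p}"
      by (rule ideal_gen_minimal) (auto simp: ideal.subspace_def)
    have coeff: "x dvd coeff (\<theta> p) (Suc j)" for j
    proof -
      have "ideal_power (ideal_gen {x}) (Suc j) \<subseteq> ideal_power (ideal_gen {x}) 1"
        by (rule ideal_power_antimono) simp
      then show ?thesis
        using coeff_\<theta>_in_ideal_power[of p "Suc j"] ideal_power_1_gen_subset[of "{x}"] ideal by blast
    qed
    \<comment> \<open>The difference collects the coefficients of positive index, each divisible by
      \<open>x\<close>.\<close>
    have "p - \<phi> p = poly (\<theta> p) 1 - coeff (\<theta> p) 0"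
      by (simp add: \<phi>_def poly_\<theta>_1 poly_0_coeff_0)
    also have "\<dots> = (\<Sum>i\<le>degree (\<theta> p). coeff (\<theta> p) i) - coeff (\<theta> p) 0"
      by (simp add: poly_altdef)
    also have "\<dots> = (\<Sum>i<degree (\<theta> p). coeff (\<theta> p) (Suc i))"
      by (simp add: sum.atMost_shift)
    finally show ?thesis using coeff by (simp add: dvd_sum)
  qed
  moreover have "\<phi> y = \<pi> y" if "linear_form y" for y
    using \<theta>_linear_form[OF that] by (simp add: \<phi>_def)
  moreover have "linear_form (\<pi> y)" if y: "linear_form y" for y
  proof -
    \<comment> \<open>Since \<open>\<pi>\<close> projects the whole ring, homogeneity has to be
      derived: \<open>y\<close> and \<open>y - \<pi> y\<close>, a scalar multiple of
      \<open>x\<close>, are linear forms.\<close>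
    have "mpoly_span {x} \<subseteq> {p. linear_form p}"
      using x by (intro mpoly.span_minimal subspace_homogeneous) auto
    then have "linear_form (y - \<pi> y)" using complement[of y] by auto
    then have "y - (y - \<pi> y) \<in> {p. linear_form p}"
      using y mpoly.subspace_diff[OF subspace_homogeneous] by blast
    then show ?thesis by simp
  qed
  moreover have "\<pi> x = 0" by (rule kernel) (simp add: mpoly.span_base)
  ultimately show ?thesis
    using x by (intro that[of \<phi>]) (simp_all add: \<phi>_def \<theta>_add \<theta>_mult)
qed

text \<open>
  Deletion and contraction of a form \<open>x = l a \<noteq> 0\<close>: modulo \<open>x\<close> the hypotheses are those for the
  remaining forms, so \<open>f = g + x * f'\<close> with \<open>g\<close> in the ideal, and cancelling \<open>x\<close> in \<open>f - g\<close> shows that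
  \<open>f'\<close> satisfies the hypotheses for the remaining forms and \<open>d - 1\<close>. Contraction may produce zero
  forms, which are therefore allowed.
\<close>

lemma in_ideal_gen_fold_productsI:
  fixes f :: "('x::{finite,linorder}, 'k::field) mpoly"
  assumes "finite N"
    and "\<And>i. i \<in> N \<Longrightarrow> linear_form (l i)"
    and "\<And>S. S \<subseteq> N \<Longrightarrow> f \<in> ideal_power (ideal_gen (l ` S)) (d + card S - card N)"
  shows "f \<in> ideal_gen (fold_products l N d)"
  using assms
proof (induction N arbitrary: l f d rule: finite_induct)
  case empty
  show ?case
  proof (cases d)
    case 0
    have "f * 1 \<in> ideal_gen (fold_products l {} 0)"
      by (rule ideal.subspace_scale[OF subspace_ideal_gen])
        (use subset_ideal_gen in \<open>force simp: fold_products_def\<close>)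
    then show ?thesis using 0 by simp
  next
    case (Suc d')
    \<comment> \<open>For \<open>S = {}\<close> the hypothesis places \<open>f\<close> in a positive
      power of the zero ideal.\<close>
    have "ideal_power (ideal_gen {}) 1 \<subseteq> {0 :: ('x, 'k) mpoly}"
      using ideal_power_1_gen_subset[of "{}"] by (simp add: ideal_gen_def)
    moreover have "f \<in> ideal_power (ideal_gen {}) 1"
      using empty(2)[of "{}"] Suc ideal_power_antimono[of 1 d "ideal_gen {}"] by auto
    ultimately have "f = 0" by blast
    then show ?thesis by (simp add: ideal.subspace_0[OF subspace_ideal_gen])
  qed
next
  case (insert a N)
  define x where "x = l a"
  have x: "linear_form x" using insert.prems(1) by (simp add: x_def)
  have forms: "linear_form (l i)" if "i \<in> N" for i using insert.prems(1) that by simp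
  \<comment> \<open>Adding \<open>a\<close> to both \<open>S\<close> and \<open>N\<close> leaves the
    exponent unchanged.\<close>
  have ins: "f \<in> ideal_power (ideal_gen (insert x (l ` S))) (d + card S - card N)" if "S \<subseteq> N" for S
  proof -
    have "a \<notin> S" "finite S" using that insert.hyps by (auto intro: finite_subset)
    then show ?thesis using insert.prems(2)[of "insert a S"] that insert.hyps by (auto simp: x_def)
  qed
  show ?case
  proof (cases "x = 0")
    case True
    have "ideal_gen (insert 0 A) = ideal_gen A" for A :: "('x, 'k) mpoly set"
      using subset_ideal_gen[of A] subset_ideal_gen[of "insert 0 A"] ideal.subspace_0[OF subspace_ideal_gen, of A]
      by (intro ideal_gen_eqI) auto
    then have "f \<in> ideal_gen (fold_products l N d)"
      using ins forms by (intro insert.IH) (auto simp: True)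
    then show ?thesis using ideal_gen_mono[OF fold_products_mono[of N "insert a N" l d]] by blast
  next
    case False
    obtain \<phi> where add: "\<And>p q. \<phi> (p + q) = \<phi> p + \<phi> q" and mult: "\<And>p q. \<phi> (p * q) = \<phi> p * \<phi> q"
      and one: "\<phi> 1 = 1" and zero: "\<phi> 0 = 0" and \<phi>x: "\<phi> x = 0"
      and dvd: "\<And>p. x dvd p - \<phi> p" and lf: "\<And>y. linear_form y \<Longrightarrow> linear_form (\<phi> y)"
      using exists_projection_along_linear_form[OF x] by blast
    have "\<phi> f \<in> ideal_gen (fold_products (\<phi> \<circ> l) N d)"
    proof (rule insert.IH)
      show "linear_form ((\<phi> \<circ> l) i)" if "i \<in> N" for i using forms[OF that] lf by simp
      fix S assume S: "S \<subseteq> N"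
      \<comment> \<open>Preimages under \<open>\<phi>\<close> form a filtration by ideals;
        \<open>x\<close> goes to 0, and the forms of \<open>S\<close> go to their
        contractions.\<close>
      let ?P = "\<lambda>k. {p. \<phi> p \<in> ideal_power (ideal_gen ((\<phi> \<circ> l) ` S)) k}"
      have "ideal_power (ideal_gen (insert x (l ` S))) k \<subseteq> ?P k" for k
      proof (rule ideal_power_gen_induct)
        show "ideal.subspace (?P k)" for k
        proof (rule ideal.subspaceI)
          show "0 \<in> ?P k" by (simp add: zero ideal.subspace_0[OF subspace_ideal_power])
        next
          fix p q assume "p \<in> ?P k" "q \<in> ?P k"
          then show "p + q \<in> ?P k"
            unfolding mem_Collect_eq add by (rule ideal.subspace_add[OF subspace_ideal_power])
        next
          fix c p assume "p \<in> ?P k"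
          then show "c * p \<in> ?P k"
            unfolding mem_Collect_eq mult by (rule ideal.subspace_scale[OF subspace_ideal_power])
        qed
        fix u b k assume u: "u \<in> insert x (l ` S)" and b: "b \<in> ?P k"
        have "\<phi> u \<in> ideal_gen ((\<phi> \<circ> l) ` S)"
          using u subset_ideal_gen[of "(\<phi> \<circ> l) ` S"] ideal.subspace_0[OF subspace_ideal_gen]
          by (auto simp: \<phi>x)
        then show "u * b \<in> ?P (Suc k)"
          using b unfolding mem_Collect_eq mult by (rule mult_in_ideal_power_Suc)
      qed simp
      then show "\<phi> f \<in> ideal_power (ideal_gen ((\<phi> \<circ> l) ` S)) (d + card S - card N)"
        using ins[OF S] by blast
    qed
    \<comment> \<open>Lifts back from the contraction: modulo \<open>x\<close>, a product of the
      contracted forms agrees with the product of the original ones.\<close>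
    moreover have "ideal_gen (fold_products (\<phi> \<circ> l) N d) \<subseteq> {p. \<exists>g \<in> ideal_gen (fold_products l N d). x dvd p - g}"
    proof (rule ideal_gen_minimal)
      have prod: "prod (\<phi> \<circ> l) A = \<phi> (prod l A)" for A
        by (induction A rule: infinite_finite_induct) (simp_all add: one mult)
      show "fold_products (\<phi> \<circ> l) N d \<subseteq> {p. \<exists>g \<in> ideal_gen (fold_products l N d). x dvd p - g}"
      proof
        fix p assume "p \<in> fold_products (\<phi> \<circ> l) N d"
        then obtain A where A: "A \<in> {A. A \<subseteq> N \<and> card A = d}" and p: "p = \<phi> (prod l A)"
          unfolding fold_products_def prod by blast
        have "prod l A \<in> fold_products l N d"
          unfolding fold_products_def by (rule imageI[OF A])
        then have "prod l A \<in> ideal_gen (fold_products l N d)"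
          using subset_ideal_gen by blast
        moreover have "x dvd p - prod l A"
          using dvd[of "prod l A"] dvd_minus_iff[of x "prod l A - p"] by (simp add: p)
        ultimately show "p \<in> {p. \<exists>g \<in> ideal_gen (fold_products l N d). x dvd p - g}"
          by blast
      qed
      show "ideal.subspace {p. \<exists>g \<in> ideal_gen (fold_products l N d). x dvd p - g}"
      proof (rule ideal.subspaceI; clarify)
        show "\<exists>g \<in> ideal_gen (fold_products l N d). x dvd 0 - g"
          using ideal.subspace_0[OF subspace_ideal_gen] by (intro bexI[of _ 0]) auto
      next
        fix p q g h assume *: "g \<in> ideal_gen (fold_products l N d)" "h \<in> ideal_gen (fold_products l N d)"
          and "x dvd p - g" "x dvd q - h"
        then have "x dvd (p - g) + (q - h)" by (intro dvd_add)
        then show "\<exists>g \<in> ideal_gen (fold_products l N d). x dvd p + q - g"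
          using ideal.subspace_add[OF subspace_ideal_gen *] by (intro bexI[of _ "g + h"]) (auto simp: algebra_simps)
      next
        fix c p g assume *: "g \<in> ideal_gen (fold_products l N d)" and "x dvd p - g"
        then have "x dvd c * (p - g)" by (intro dvd_mult)
        then show "\<exists>g \<in> ideal_gen (fold_products l N d). x dvd c * p - g"
          using ideal.subspace_scale[OF subspace_ideal_gen *] by (intro bexI[of _ "c * g"]) (auto simp: algebra_simps)
      qed
    qed
    ultimately obtain g where g: "g \<in> ideal_gen (fold_products l N d)" and "x dvd \<phi> f - g" by blast
    then have "x dvd (f - \<phi> f) + (\<phi> f - g)" using dvd by (intro dvd_add)
    then obtain f' where f': "f - g = x * f'" by (auto elim: dvdE)
    have g': "g \<in> ideal_gen (fold_products l (insert a N) d)"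
      using g ideal_gen_mono[OF fold_products_mono[of N "insert a N" l d]] by blast
    have "x * f' \<in> ideal_gen (fold_products l (insert a N) d)"
    proof (cases d)
      case 0
      have "(x * f') * 1 \<in> ideal_gen (fold_products l (insert a N) 0)"
        by (rule ideal.subspace_scale[OF subspace_ideal_gen])
          (use subset_ideal_gen in \<open>force simp: fold_products_def\<close>)
      then show ?thesis using 0 by simp
    next
      case (Suc d')
      \<comment> \<open>Here \<open>x * f' = f - g\<close>, with \<open>f\<close> covered by the
        hypothesis and \<open>g\<close> by the inclusion already shown.\<close>
      have cond: "x * f' \<in> ideal_power (ideal_gen (l ` S)) (d + card S - card (insert a N))"
        if "S \<subseteq> insert a N" for S
        unfolding f'[symmetric]
        using insert.prems(2)[OF that] g' ideal_gen_fold_products_subset[OF _ that, of l d] insert.hyps(1)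
        by (intro ideal.subspace_diff[OF subspace_ideal_power]) auto
      have "f' \<in> ideal_gen (fold_products l N d')"
      proof (rule insert.IH[OF forms])
        fix S assume S: "S \<subseteq> N"
        have fin: "finite S" "a \<notin> S" using S insert.hyps by (auto intro: finite_subset)
        have U: "linear_form u" if "u \<in> l ` S" for u using that S forms by auto
        show "f' \<in> ideal_power (ideal_gen (l ` S)) (d' + card S - card N)"
        proof (cases "x \<in> mpoly_span (l ` S)")
          case False
          \<comment> \<open>Passing from \<open>d\<close> to \<open>d'\<close> offsets passing from
            \<open>insert a N\<close> to \<open>N\<close>, so \<open>S\<close> itself yields the
            exponent wanted.\<close>
          have "d + card S - card (insert a N) = d' + card S - card N"
            using Suc insert.hyps by simp
          then have "x * f' \<in> ideal_power (ideal_gen (l ` S)) (d' + card S - card N)"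
            using cond[of S] S by (simp only: subset_insertI2)
          with U x False show ?thesis by (rule cancel_linear_form_outside_span)
        next
          case True
          \<comment> \<open>Adding \<open>a\<close> to \<open>S\<close> keeps the ideal and gains
            one in the exponent, which cancelling \<open>x\<close> loses again. If
            \<open>d' + card S < card N\<close>, truncation gives exponent 0 and the claim is
            trivial.\<close>
          show ?thesis
          proof (cases "d' + card S < card N")
            case False
            have "ideal_gen (l ` insert a S) = ideal_gen (l ` S)"
              using True mpoly_span_subset_ideal_gen[of "l ` S"] subset_ideal_gen[of "l ` S"]
                subset_ideal_gen[of "l ` insert a S"]
              by (intro ideal_gen_eqI) (auto simp: x_def)
            moreover have "d + card (insert a S) - card (insert a N) = Suc (d' + card S - card N)"
              using False fin insert.hyps Suc by simp
            moreover have "insert a S \<subseteq> insert a N" using S by blast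
            ultimately have "x * f' \<in> ideal_power (ideal_gen (l ` S)) (Suc (d' + card S - card N))"
              using cond[of "insert a S"] by (simp del: ideal_power.simps)
            with U x \<open>x \<noteq> 0\<close> show ?thesis by (rule cancel_linear_form_Suc)
          qed simp
        qed
      qed
      then show ?thesis
        using mult_in_ideal_gen_fold_products[OF insert.hyps, of f' l d'] Suc by (simp add: x_def)
    qed
    then have "g + x * f' \<in> ideal_gen (fold_products l (insert a N) d)"
      by (rule ideal.subspace_add[OF subspace_ideal_gen g'])
    then show ?thesis by (simp flip: f')
  qed
qed

section \<open>Homogeneous components of the numerators\<close>

text \<open>These combinations form an ideal containing the generators. Coefficients are indexed by
  \<open>I\<close>, so \<open>g\<close> may repeat values.\<close>

lemma in_ideal_gen_image_finite:
  fixes g :: "'i \<Rightarrow> 'a::comm_ring_1"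
  assumes "finite I" and "p \<in> ideal_gen (g ` I)"
  shows "\<exists>h. p = (\<Sum>i\<in>I. h i * g i)"
proof -
  let ?L = "\<lambda>h :: 'i \<Rightarrow> 'a. \<Sum>i\<in>I. h i * g i"
  have "ideal_gen (g ` I) \<subseteq> {p. \<exists>h. p = ?L h}"
  proof (rule ideal_gen_minimal)
    have "g j = ?L (\<lambda>i. if i = j then 1 else 0)" if "j \<in> I" for j
    proof -
      have "?L (\<lambda>i. if i = j then 1 else 0) = (\<Sum>i\<in>I. if i = j then g i else 0)"
        by (rule sum.cong) auto
      then show ?thesis using sum.delta[OF assms(1), of j g] that by simp
    qed
    then show "g ` I \<subseteq> {p. \<exists>h. p = ?L h}" by auto
    have zero: "0 = ?L (\<lambda>_. 0)" by simp
    have add: "?L h + ?L k = ?L (\<lambda>i. h i + k i)" for h k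
      by (simp only: distrib_right sum.distrib)
    have scale: "c * ?L h = ?L (\<lambda>i. c * h i)" for c h
      by (simp only: sum_distrib_left mult.assoc)
    show "ideal.subspace {p. \<exists>h. p = ?L h}"
    proof (rule ideal.subspaceI)
      show "0 \<in> {p. \<exists>h. p = ?L h}" using zero by (intro CollectI exI)
    next
      fix p q assume "p \<in> {p. \<exists>h. p = ?L h}" "q \<in> {p. \<exists>h. p = ?L h}"
      then obtain h k where "p = ?L h" "q = ?L k" by (elim CollectE exE)
      then have "p + q = ?L (\<lambda>i. h i + k i)" by (simp only: add)
      then show "p + q \<in> {p. \<exists>h. p = ?L h}" by (intro CollectI exI)
    next
      fix c p assume "p \<in> {p. \<exists>h. p = ?L h}"
      then obtain h where "p = ?L h" by (elim CollectE exE)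
      then have "c * p = ?L (\<lambda>i. c * h i)" by (simp only: scale)
      then show "c * p \<in> {p. \<exists>h. p = ?L h}" by (intro CollectI exI)
    qed
  qed
  then show ?thesis using assms(2) by (blast dest: subsetD)
qed

text \<open>For the zero projection the pencil is \<open>p \<mapsto> p (t * x)\<close>, so its coefficients are the homogeneous components.\<close>

interpretation grading: pencil "\<lambda>_. 0 :: ('x::finite, 'k::field) mpoly" UNIV
  by (rule pencil.intro) (simp_all add: mpoly_pair.module_hom_zero)

lemma \<theta>_grading_eq_sum:
  "grading.\<theta> p = (\<Sum>m\<in>Poly_Mapping.keys p. monom (Poly_Mapping.single m (Poly_Mapping.lookup p m)) (monom_deg m))"
  unfolding grading.\<theta>_def
proof (rule sum.cong[OF refl])
  fix m
  have "(\<Prod>v\<in>A. monom (Var v :: ('a, 'b) mpoly) 1 ^ Poly_Mapping.lookup m v)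
      = monom (\<Prod>v\<in>A. Var v ^ Poly_Mapping.lookup m v) (\<Sum>v\<in>A. Poly_Mapping.lookup m v)" for A
    by (induction A rule: infinite_finite_induct) (simp_all add: monom_power mult_monom)
  from this[of UNIV]
  have "(\<Prod>v\<in>UNIV. [:0, Var v :: ('a, 'b) mpoly:] ^ Poly_Mapping.lookup m v) = monom (Poly_Mapping.single m 1) (monom_deg m)"
    by (simp add: prod_Var_power monom_deg_eq_sum monom_Suc monom_0)
  then show "[:Poly_Mapping.single 0 (Poly_Mapping.lookup p m):] * (\<Prod>v\<in>UNIV. [:0, Var v - 0:] ^ Poly_Mapping.lookup m v)
      = monom (Poly_Mapping.single m (Poly_Mapping.lookup p m)) (monom_deg m)"
    by (simp add: smult_monom mult_single)
qed

lemma \<theta>_grading_homogeneous: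
  assumes "homogeneous e p"
  shows "grading.\<theta> p = monom p e"
proof -
  have "grading.\<theta> p = (\<Sum>m\<in>Poly_Mapping.keys p. monom (Poly_Mapping.single m (Poly_Mapping.lookup p m)) e)"
    unfolding \<theta>_grading_eq_sum using assms by (intro sum.cong) (auto simp: homogeneous_def)
  also have "\<dots> = monom (\<Sum>m\<in>Poly_Mapping.keys p. Poly_Mapping.single m (Poly_Mapping.lookup p m)) e"
    by (simp add: monom_sum)
  finally show ?thesis by (simp only: sum_keys_single)
qed

lemma homogeneous_coeff_\<theta>_grading: "homogeneous j (coeff (grading.\<theta> p) j)"
proof -
  have "coeff (grading.\<theta> p) j \<in> {p. homogeneous j p}"
    unfolding \<theta>_grading_eq_sum coeff_sum
    by (rule mpoly.subspace_sum[OF subspace_homogeneous]) (auto simp: homogeneous_def)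
  then show ?thesis by simp
qed

text \<open>Compare components of degree \<open>e\<close>: each product has degree \<open>d\<close>,
  so only the component of degree \<open>e - d\<close> of \<open>h A\<close> contributes.\<close>

lemma homogeneous_numerators:
  fixes f :: "('x::finite, 'k::field) mpoly"
  assumes f: "homogeneous e f" "f = (\<Sum>A\<in>\<A>. h A * (\<Prod>i\<in>A. l i))" and de: "d \<le> e"
    and \<A>: "\<And>A. A \<in> \<A> \<Longrightarrow> card A = d" and l: "\<And>A i. A \<in> \<A> \<Longrightarrow> i \<in> A \<Longrightarrow> linear_form (l i)"
  obtains h' where "\<And>A. homogeneous (e - d) (h' A)" "f = (\<Sum>A\<in>\<A>. h' A * (\<Prod>i\<in>A. l i))"
proof
  define h' where "h' = (\<lambda>A. coeff (grading.\<theta> (h A)) (e - d))"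
  show "homogeneous (e - d) (h' A)" for A
    unfolding h'_def by (rule homogeneous_coeff_\<theta>_grading)
  have prod: "grading.\<theta> (\<Prod>i\<in>A. l i) = monom (\<Prod>i\<in>A. l i) d" if A: "A \<in> \<A>" for A
  proof -
    have "grading.\<theta> (\<Prod>i\<in>A. l i) = (\<Prod>i\<in>A. monom (l i) 1)"
      unfolding grading.\<theta>_prod
      by (rule prod.cong[OF refl]) (rule \<theta>_grading_homogeneous[OF l[OF A]])
    also have "\<dots> = monom (\<Prod>i\<in>A. l i) (card A)"
      by (induction A rule: infinite_finite_induct) (simp_all add: mult_monom)
    finally show ?thesis using \<A>[OF A] by simp
  qed
  have "f = coeff (grading.\<theta> f) e" by (simp add: \<theta>_grading_homogeneous[OF f(1)])
  also have "\<dots> = (\<Sum>A\<in>\<A>. coeff (grading.\<theta> (h A * (\<Prod>i\<in>A. l i))) e)"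
    by (subst f(2)) (simp add: grading.\<theta>_sum coeff_sum)
  also have "\<dots> = (\<Sum>A\<in>\<A>. h' A * (\<Prod>i\<in>A. l i))"
  proof (rule sum.cong[OF refl])
    fix A assume "A \<in> \<A>"
    then have "grading.\<theta> (h A * (\<Prod>i\<in>A. l i)) = monom (\<Prod>i\<in>A. l i) d * grading.\<theta> (h A)"
      by (simp add: grading.\<theta>_mult prod mult.commute)
    then show "coeff (grading.\<theta> (h A * (\<Prod>i\<in>A. l i))) e = h' A * (\<Prod>i\<in>A. l i)"
      using de by (simp add: coeff_monom_mult h'_def mult.commute)
  qed
  finally show "f = (\<Sum>A\<in>\<A>. h' A * (\<Prod>i\<in>A. l i))" .
qed

lemma total_deg_le_homogeneous: "homogeneous e p \<Longrightarrow> total_deg p \<le> e"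
  by (simp add: total_deg_def homogeneous_def)

lemma total_deg_homogeneous:
  assumes "homogeneous e p" "p \<noteq> 0"
  shows "total_deg p = e"
proof -
  obtain m where "m \<in> Poly_Mapping.keys p" using assms(2) by fastforce
  then have "monom_deg ` Poly_Mapping.keys p = {e}"
    using assms(1) unfolding homogeneous_def by force
  then show ?thesis by (simp add: total_deg_def)
qed

section \<open>Flats and partial fractions\<close>

text \<open>A basis \<open>B\<close> of the smaller span stays independent when \<open>l i\<close>
  is added; \<open>B\<close> is finite because \<open>S\<close> is, so its cardinality
  grows.\<close>

lemma rk_insert_gt:
  assumes "finite S" "l i \<notin> mpoly_span (l ` S)"
  shows "rk l (S \<union> {i}) > rk l S"
proof -
  obtain B where B: "B \<subseteq> l ` S" "\<not> mpoly.dependent B" "l ` S \<subseteq> mpoly_span B"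
    by (rule mpoly.maximal_independent_subset)
  have span: "mpoly_span (l ` S) = mpoly_span B"
    using B mpoly.span_mono[OF B(1)] mpoly.span_minimal[OF B(3) mpoly.subspace_span] by blast
  have "mpoly_span (l ` (S \<union> {i})) = mpoly_span (insert (l i) B)"
    using span by (simp add: mpoly.span_insert)
  moreover have "\<not> mpoly.dependent (insert (l i) B)"
    using assms(2) B(2) span by (simp add: mpoly.independent_insertI)
  moreover have "finite B" "l i \<notin> B"
    using B(1) assms finite_subset[of B "l ` S"] mpoly.span_base[of "l i" "l ` S"] by auto
  ultimately show ?thesis
    unfolding rk_def span by (simp add: mpoly.dim_span_eq_card_independent B(2) del: mpoly.dim_span)
qed

text \<open>Forms already in the span do not enlarge it, so an index outside the closure has its
  form outside the span of the closure.\<close>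

lemma flat_closure:
  assumes "S \<subseteq> {1..n}"
  shows "flat n l {i \<in> {1..n}. l i \<in> mpoly_span (l ` S)}" (is "flat n l ?T")
  unfolding flat_def
proof (intro conjI ballI)
  fix i assume i: "i \<in> {1..n} - ?T"
  have "mpoly_span (l ` ?T) \<subseteq> mpoly_span (l ` S)"
    by (rule mpoly.span_minimal) auto
  then show "rk l ?T < rk l (?T \<union> {i})"
    using i by (intro rk_insert_gt) auto
qed auto

text \<open>Extends the hypothesis from large flats to all subsets, as the induction requires. The
  closure \<open>T\<close> is large enough as soon as \<open>d + card S > n\<close>; otherwise the
  exponent is 0.\<close>

lemma vanishes_to_order_subset_of_flats:
  assumes flats: "\<forall>S. flat n l S \<and> card S \<ge> n - d + 1 \<longrightarrow> vanishes_to_order (d + card S - n) l S f"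
    and S: "S \<subseteq> {1..n}" and "d \<le> n"
  shows "f \<in> ideal_power (ideal_gen (l ` S)) (d + card S - n)"
proof (cases "d + card S \<le> n")
  case False
  define T where "T = {i \<in> {1..n}. l i \<in> mpoly_span (l ` S)}"
  have ST: "S \<subseteq> T" using S by (auto simp: T_def mpoly.span_base)
  have "finite T" by (simp add: T_def)
  then have card: "card S \<le> card T" using ST by (rule card_mono)
  have "ideal_gen (l ` T) = ideal_gen (l ` S)"
  proof (rule ideal_gen_eqI)
    show "l ` T \<subseteq> ideal_gen (l ` S)"
      using mpoly_span_subset_ideal_gen[of "l ` S"] by (auto simp: T_def)
    show "l ` S \<subseteq> ideal_gen (l ` T)"
      using ST subset_ideal_gen[of "l ` T"] by blast
  qed
  moreover have "vanishes_to_order (d + card T - n) l T f"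
  proof -
    have "flat n l T" unfolding T_def by (rule flat_closure[OF S])
    moreover have "card T \<ge> n - d + 1" using False card \<open>d \<le> n\<close> by simp
    ultimately show ?thesis using flats by blast
  qed
  ultimately have "f \<in> ideal_power (ideal_gen (l ` S)) (d + card T - n)"
    by (simp add: vanishes_to_order_def)
  moreover have "d + card S - n \<le> d + card T - n" using card by simp
  ultimately show ?thesis
    using ideal_power_antimono[of "d + card S - n" "d + card T - n" "ideal_gen (l ` S)"] by blast
qed simp

section \<open>Clearing denominators\<close>

lemma sum_Fract_same_denominator:
  fixes q :: "'a::idom"
  assumes q: "q \<noteq> 0"
  shows "(\<Sum>i\<in>I. Fract (g i) q) = Fract (\<Sum>i\<in>I. g i) q"
proof -
  have zero: "0 = Fract 0 q"
    unfolding Zero_fract_def using q by (subst eq_fract) auto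
  have add: "Fract a q + Fract b q = Fract (a + b) q" for a b
  proof -
    have "Fract a q + Fract b q = Fract (q * (a + b)) (q * q)"
      using q by (simp add: distrib_left mult.commute)
    also have "\<dots> = Fract (a + b) q" by (rule mult_fract_cancel[OF q])
    finally show ?thesis .
  qed
  show ?thesis
    by (induction I rule: infinite_finite_induct) (simp_all add: zero[symmetric] add del: add_fract)
qed

text \<open>Over the common denominator \<open>prod l N\<close> the numerator of \<open>J\<close>
  acquires the product over the complement of \<open>J\<close>.\<close>

lemma partial_fractions_iff:
  fixes f :: "'a::idom" and l :: "nat \<Rightarrow> 'a"
  assumes N: "finite N" and l: "\<And>i. i \<in> N \<Longrightarrow> l i \<noteq> 0" and \<J>: "\<And>J. J \<in> \<J> \<Longrightarrow> J \<subseteq> N"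
  shows "Fract f (prod l N) = (\<Sum>J\<in>\<J>. Fract (h J) (prod l J)) \<longleftrightarrow>
    f = (\<Sum>J\<in>\<J>. h J * prod l (N - J))"
proof -
  have nz: "prod l J \<noteq> 0" if "J \<subseteq> N" for J
    using l that finite_subset[OF that N] by (simp add: prod_zero_iff subset_iff)
  have "Fract (h J) (prod l J) = Fract (h J * prod l (N - J)) (prod l N)" if "J \<in> \<J>" for J
  proof -
    have J: "J \<subseteq> N" using that by (rule \<J>)
    have "Fract (h J) (prod l J) = Fract (prod l (N - J) * h J) (prod l (N - J) * prod l J)"
      by (rule mult_fract_cancel[symmetric]) (rule nz, blast)
    also have "\<dots> = Fract (h J * prod l (N - J)) (prod l N)"
      by (simp only: prod.subset_diff[OF J N] mult.commute)
    finally show ?thesis .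
  qed
  then have "(\<Sum>J\<in>\<J>. Fract (h J) (prod l J)) = (\<Sum>J\<in>\<J>. Fract (h J * prod l (N - J)) (prod l N))"
    by (rule sum.cong[OF refl])
  also have "\<dots> = Fract (\<Sum>J\<in>\<J>. h J * prod l (N - J)) (prod l N)"
    by (rule sum_Fract_same_denominator[OF nz[OF subset_refl]])
  finally show ?thesis using nz[OF subset_refl] by (simp add: eq_fract)
qed

theorem theorem1p2:
  fixes f :: "('x::{finite,linorder}, 'k::field) mpoly"
    and l :: "nat \<Rightarrow> ('x, 'k) mpoly"
    and d e n :: nat
  assumes "homogeneous e f" and "e \<ge> d" and "d \<ge> 1"
    and "\<And>i. i \<in> {1..n} \<Longrightarrow> linear_form (l i) \<and> l i \<noteq> 0"
    and "n \<ge> d"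
  shows "has_PFD d n l f \<longleftrightarrow>
    (\<forall>S. flat n l S \<and> card S \<ge> n - d + 1 \<longrightarrow> vanishes_to_order (d + card S - n) l S f)"
proof
  let ?N = "{1..n}"
  let ?\<J> = "{J. J \<subseteq> ?N \<and> card J = n - d}"
  have card_compl: "card (?N - J) = d" if "J \<in> ?\<J>" for J
    using that \<open>n \<ge> d\<close> finite_subset[of J ?N] by (simp add: card_Diff_subset)
  have pf: "Fract f (prod l ?N) = (\<Sum>J\<in>?\<J>. Fract (h J) (prod l J)) \<longleftrightarrow>
      f = (\<Sum>J\<in>?\<J>. h J * prod l (?N - J))" for h
    using assms(4) by (intro partial_fractions_iff) auto
  {
    assume "has_PFD d n l f"
    then obtain h where f: "f = (\<Sum>J\<in>?\<J>. h J * prod l (?N - J))"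
      using pf unfolding has_PFD_def by blast
    have "h J * prod l (?N - J) \<in> ideal_gen (fold_products l ?N d)" if J: "J \<in> ?\<J>" for J
    proof -
      have "prod l (?N - J) \<in> fold_products l ?N d"
        unfolding fold_products_def using card_compl[OF J] by (intro imageI) auto
      then show ?thesis
        using subset_ideal_gen[of "fold_products l ?N d"] ideal.subspace_scale[OF subspace_ideal_gen] by blast
    qed
    then have "f \<in> ideal_gen (fold_products l ?N d)"
      unfolding f by (rule ideal.subspace_sum[OF subspace_ideal_gen])
    then have "vanishes_to_order (d + card S - n) l S f" if "flat n l S" for S
      using ideal_gen_fold_products_subset[of ?N S l d] that
      unfolding vanishes_to_order_def flat_def by auto
    then show "\<forall>S. flat n l S \<and> card S \<ge> n - d + 1 \<longrightarrow> vanishes_to_order (d + card S - n) l S f"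
      by blast
  next
    assume flats: "\<forall>S. flat n l S \<and> card S \<ge> n - d + 1 \<longrightarrow> vanishes_to_order (d + card S - n) l S f"
    let ?\<A> = "{A. A \<subseteq> ?N \<and> card A = d}"
    have "f \<in> ideal_gen (fold_products l ?N d)"
      using vanishes_to_order_subset_of_flats[OF flats] assms(4,5)
      by (intro in_ideal_gen_fold_productsI) auto
    then have "\<exists>h. f = (\<Sum>A\<in>?\<A>. h A * prod l A)"
      unfolding fold_products_def by (intro in_ideal_gen_image_finite) auto
    then obtain h0 where "f = (\<Sum>A\<in>?\<A>. h0 A * prod l A)" ..
    \<comment> \<open>Homogeneous coefficients are what the degree bound needs.\<close>
    then obtain h where h: "\<And>A. homogeneous (e - d) (h A)" and f: "f = (\<Sum>A\<in>?\<A>. h A * prod l A)"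
      by (rule homogeneous_numerators[OF assms(1) _ assms(2)]) (use assms(4) in auto)
    \<comment> \<open>For \<open>f = 0\<close> the bound would read
      \<open>total_deg (h' J) + d \<le> 0\<close>, which fails as \<open>d \<ge> 1\<close>; the
      numerators are then set to zero.\<close>
    define h' where "h' = (\<lambda>J. if f = 0 then 0 else h (?N - J))"
    have "f = (\<Sum>J\<in>?\<J>. h (?N - J) * prod l (?N - J))"
      unfolding f
    \<comment> \<open>Complementation exchanges the \<open>d\<close>-subsets with the index sets of
      the decomposition.\<close>
    proof (rule sum.reindex_bij_witness[of _ "\<lambda>J. ?N - J" "\<lambda>A. ?N - A"])
      fix A assume A: "A \<in> ?\<A>"
      then have "finite A" using finite_subset[of A ?N] by simp
      with A show "?N - A \<in> ?\<J>" by (simp add: card_Diff_subset)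
      show double: "?N - (?N - A) = A" using A by blast
      show "h (?N - (?N - A)) * prod l (?N - (?N - A)) = h A * prod l A" by (simp only: double)
    next
      fix J assume J: "J \<in> ?\<J>"
      then show "?N - (?N - J) = J" by blast
      show "?N - J \<in> ?\<A>" using card_compl[OF J] by blast
    qed
    then have "f = (\<Sum>J\<in>?\<J>. h' J * prod l (?N - J))"
      unfolding h'_def by (cases "f = 0") (simp_all only: if_True if_False simp_thms mult_zero_left sum.neutral_const)
    moreover have "h' J = 0 \<or> total_deg (h' J) + d \<le> total_deg f" for J
    proof (cases "f = 0")
      case False
      then show ?thesis
        using total_deg_le_homogeneous[OF h[of "?N - J"]] total_deg_homogeneous[OF assms(1) False] assms(2)
        by (simp add: h'_def le_diff_conv2)
    qed (simp add: h'_def)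
    ultimately show "has_PFD d n l f"
      unfolding has_PFD_def pf by blast
  }
qed

end
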